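(* Let $q$ be a prime power, and let $\mathrm{AG}(3,q)$ be the affine space obtained from $\mathrm{PG}(3,q)$ by removing the plane at infinity $\pi_\infty$. Suppose that $\mathcal{L}$ is a Cameron-Liebler line class in $\mathrm{PG}(3,q)$ of parameter $x$. Then $\mathcal{L}$ defines a Cameron-Liebler line class in $\mathrm{AG}(3,q)$ with the same parameter $x$ (that is, the set of lines of $\mathcal{L}$ not contained in $\pi_\infty$ is a Cameron-Liebler line class of parameter $x$ in $\mathrm{AG}(3,q)$) if and only if $\mathcal{L}$ is disjoint from the set of lines contained in $\pi_\infty$.
   Context: $\mathrm{PG}(3,q)$ and $\mathrm{AG}(3,q)$ are the 3-dimensional projective and affine spaces over $\mathbb{F}_q$. $\mathrm{AG}(3,q)$ is obtained from $\mathrm{PG}(3,q)$ by removing a fixed plane $\pi_\infty$ (the plane at infinity); lines of $\mathrm{AG}(3,q)$ are identified with the lines of $\mathrm{PG}(3,q)$ not contained in $\pi_\infty$. A line spread of $\mathrm{PG}(3,q)$ (resp. $\mathrm{AG}(3,q)$) is a set of pairwise disjoint lines of that space that partitions the points of that space. A Cameron-Liebler line class of parameter $x$ in $\mathrm{PG}(3,q)$ (resp. $\mathrm{AG}(3,q)$) is a set $\mathcal{L}$ of lines of that space such that $|\mathcal{L}\cap\mathcal{S}|=x$ for every line spread $\mathcal{S}$ of that space. *)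

theory Defs
  imports "HOL-Analysis.Cartesian_Space" "HOL-Library.Disjoint_Sets"
begin

text \<open>
  The field \<open>\<F>\<^sub>q\<close> is an arbitrary type \<open>'a\<close> of class \<open>{field, finite}\<close>, so that \<open>q = CARD('a)\<close>.
  A point of \<open>PG(3,q)\<close> is a one-dimensional subspace of \<open>'a ^ 4\<close>. Lines and planes are represented
  by the sets of points they contain.
\<close>

definition pg_points :: "('a::{field,finite} ^ 4) set set" where
  "pg_points = {P. vec.subspace P \<and> vec.dim P = 1}"

definition points_of :: "('a::{field,finite} ^ 4) set \<Rightarrow> ('a ^ 4) set set" where
  "points_of W = {P \<in> pg_points. P \<subseteq> W}"

definition pg_lines :: "('a::{field,finite} ^ 4) set set set" where
  "pg_lines = {points_of W | W. vec.subspace W \<and> vec.dim W = 2}"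

definition pg_planes :: "('a::{field,finite} ^ 4) set set set" where
  "pg_planes = {points_of W | W. vec.subspace W \<and> vec.dim W = 3}"

text \<open>
  \<open>AG(3,q)\<close> with plane at infinity \<open>\<pi>\<close>. A projective line \<open>l\<close> not contained in \<open>\<pi>\<close> is identified
  with the affine line \<open>l - \<pi>\<close>; thus two affine lines meeting only at infinity are disjoint.
\<close>

definition ag_points :: "('a::{field,finite} ^ 4) set set \<Rightarrow> ('a ^ 4) set set" where
  "ag_points \<pi> = pg_points - \<pi>"

definition affine_part ::
  "('a::{field,finite} ^ 4) set set \<Rightarrow> ('a ^ 4) set set set \<Rightarrow> ('a ^ 4) set set set" where
  "affine_part \<pi> L = {l - \<pi> | l. l \<in> L \<and> \<not> l \<subseteq> \<pi>}"

definition ag_lines :: "('a::{field,finite} ^ 4) set set \<Rightarrow> ('a ^ 4) set set set" where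
  "ag_lines \<pi> = affine_part \<pi> pg_lines"

text \<open>
  The next two notions apply to any space given by a set of points \<open>X\<close> and a set of lines \<open>\<Lambda>\<close>,
  each line being a subset of \<open>X\<close>.
\<close>

definition line_spread :: "'p set \<Rightarrow> 'p set set \<Rightarrow> 'p set set \<Rightarrow> bool" where
  "line_spread X \<Lambda> S \<longleftrightarrow> S \<subseteq> \<Lambda> \<and> partition_on X S"

definition cameron_liebler :: "'p set \<Rightarrow> 'p set set \<Rightarrow> nat \<Rightarrow> 'p set set \<Rightarrow> bool" where
  "cameron_liebler X \<Lambda> x L \<longleftrightarrow>
     L \<subseteq> \<Lambda> \<and> (\<forall>S. line_spread X \<Lambda> S \<longrightarrow> card (L \<inter> S) = x)"

end

(*
  Summing |L \<inter> S| over the q^4 translates S of a regular spread through a line l shows that L has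
  exactly q^2 (x - [l \<in> L]) lines skew to l. Counting the lines of L that meet l instead, one obtains
  point weights whose sum over every line l is [l \<in> L].

  If L has no line in the plane at infinity, the weights vanish on that plane, so the intersection
  of L with any affine spread has size the total weight, which is x. Conversely, if L contains a line
  l at infinity, then removing l from a projective spread through l leaves an affine spread that
  contains only x - 1 lines of L.
*)

theory Submission
  imports Defs "HOL-Library.Product_Plus"
begin

text \<open>The obstacle is that an affine spread need not come from a projective one: a parallel
  class is an affine spread, yet its lines all meet in one point at infinity. The hypothesis on
  \<open>L\<close> says nothing about such a spread directly. Weights remove the obstacle: once the
  points at infinity carry no weight, every family of lines covering each affine point exactly once
  has the same total, however its lines meet at infinity. The weights live on vectors instead of
  points. The zero vector has weight 0, and a point is represented by its q - 1 nonzero vectors,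
  which share one weight. Lines become two-dimensional subspaces, so that intersections are governed
  by the dimension formula.\<close>

section \<open>Points, lines and spreads in terms of vectors\<close>

definition line_space :: "('a::{field,finite} ^ 4) set \<Rightarrow> bool" where
  "line_space W \<longleftrightarrow> vec.subspace W \<and> vec.dim W = 2"

lemma pg_points_eq: "pg_points = {vec.span {v} | v. v \<noteq> 0}"
proof (intro set_eqI iffI)
  fix P :: "('a ^ 4) set"
  assume "P \<in> pg_points"
  then have P: "vec.subspace P" "vec.dim P = 1" by (auto simp: pg_points_def)
  obtain B where B: "B \<subseteq> P" "vec.independent B" "P \<subseteq> vec.span B" "card B = 1"
    using vec.basis_exists[of P] P by metis
  then obtain v where v: "B = {v}" by (metis card_1_singletonE)
  have "P = vec.span {v}"
    using B v P(1) by (metis subset_antisym vec.span_minimal)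
  moreover have "v \<noteq> 0" using B(2) v by (auto simp: vec.dependent_single)
  ultimately show "P \<in> {vec.span {v} | v. v \<noteq> 0}" by blast
next
  fix P :: "('a ^ 4) set"
  assume "P \<in> {vec.span {v} | v. v \<noteq> 0}"
  then obtain v where "P = vec.span {v}" "v \<noteq> 0" by blast
  then show "P \<in> pg_points"
    by (simp add: pg_points_def vec.dim_span_eq_card_independent vec.dependent_single)
qed

lemma span_mem_points_of_iff:
  assumes "vec.subspace W" "v \<noteq> 0"
  shows "vec.span {v} \<in> points_of W \<longleftrightarrow> v \<in> W"
proof
  assume "vec.span {v} \<in> points_of W"
  then show "v \<in> W" using vec.span_base[of v "{v}"] by (auto simp: points_of_def)
next
  assume "v \<in> W"
  then have "vec.span {v} \<subseteq> W" using assms by (simp add: vec.span_minimal)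
  then show "vec.span {v} \<in> points_of W" using assms(2) by (auto simp: points_of_def pg_points_eq)
qed

lemma points_of_subset_iff:
  assumes "vec.subspace W" "vec.subspace H"
  shows "points_of W \<subseteq> points_of H \<longleftrightarrow> W \<subseteq> H"
proof
  assume *: "points_of W \<subseteq> points_of H"
  show "W \<subseteq> H"
  proof
    fix v assume "v \<in> W"
    then show "v \<in> H"
      using * assms by (cases "v = 0") (auto simp: vec.subspace_0 simp flip: span_mem_points_of_iff)
  qed
qed (auto simp: points_of_def)

lemma points_of_zero: "points_of {0} = {}"
proof -
  have "vec.span {v} \<notin> points_of {0}" if "v \<noteq> 0" for v :: "'a ^ 4"
    using span_mem_points_of_iff[of "{0}" v] that by (simp add: vec.subspace_single_0)
  then show ?thesis by (auto simp: points_of_def pg_points_eq)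
qed

text \<open>Fix \<open>v\<close> in \<open>W\<close> outside \<open>H\<close>. A vector
  \<open>u\<close> of \<open>W\<close> inside \<open>H\<close> is \<open>(u + v) - v\<close>, where
  both terms lie outside \<open>H\<close>. For lines this says that the affine part determines the
  projective line.\<close>

lemma subspace_eqI_diff:
  assumes W: "vec.subspace W" "vec.subspace W'" and H: "vec.subspace H"
    and "\<not> W \<subseteq> H" and eq: "W - H = W' - H"
  shows "W = W'"
proof -
  obtain v where v: "v \<in> W" "v \<notin> H" using assms by blast
  have v': "v \<in> W'" using v eq by blast
  have *: "u \<in> B" if "u \<in> A" "vec.subspace A" "vec.subspace B" "v \<in> A" "v \<in> B" "A - H = B - H" 
    for u A B
  proof (cases "u \<in> H")
    case True
    have "u + v \<notin> H"
      using vec.subspace_diff[OF H _ True, of "u + v"] v by auto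
    then have "u + v \<in> B" using that vec.subspace_add by blast
    from vec.subspace_diff[OF that(3) this that(5)] show ?thesis by simp
  next
    case False
    then show ?thesis using that by blast
  qed
  show ?thesis using *[of _ W W'] *[of _ W' W] assms v v' by (intro set_eqI) metis
qed

text \<open>This trades point sets for vectors: a spread is a set of two-dimensional subspaces in
  which each vector outside \<open>H\<close> occurs exactly once, while vectors of \<open>H\<close>
  are unconstrained. \<open>H\<close> is an arbitrary subspace, so that \<open>H = {0}\<close>
  covers the projective space as well.\<close>

lemma cameron_liebler_iff:
  assumes H: "vec.subspace H" and L: "L \<subseteq> pg_lines"
  shows "cameron_liebler (ag_points (points_of H)) (ag_lines (points_of H)) x
           (affine_part (points_of H) L) \<longleftrightarrow>
         (\<forall>S. (\<forall>W\<in>S. line_space W \<and> \<not> W \<subseteq> H) \<and> (\<forall>v. v \<notin> H \<longrightarrow> (\<exists>!W. W \<in> S \<and> v \<in> W)) \<longrightarrow>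
           card {W \<in> S. points_of W \<in> L} = x)"
proof -
  define Om where "Om = {W. line_space W \<and> \<not> W \<subseteq> H}"
  define \<phi> where "\<phi> = (\<lambda>W. points_of W - points_of H)"
  have mem: "vec.span {v} \<in> \<phi> W \<longleftrightarrow> v \<in> W" if "v \<notin> H" "W \<in> Om" for v W
  proof -
    have "v \<noteq> 0" using that(1) vec.subspace_0[OF H] by blast
    then show ?thesis
      using that H by (simp add: \<phi>_def Om_def line_space_def span_mem_points_of_iff)
  qed
  have inj: "inj_on \<phi> Om"
  proof (rule inj_onI)
    fix W W' assume *: "W \<in> Om" "W' \<in> Om" "\<phi> W = \<phi> W'"
    then have "W - H = W' - H" using mem by blast
    then show "W = W'" using * H by (intro subspace_eqI_diff[of W W' H]) (auto simp: Om_def line_space_def)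
  qed
  have ag: "ag_lines (points_of H) = \<phi> ` Om"
    using points_of_subset_iff[OF _ H]
    by (auto simp: ag_lines_def affine_part_def pg_lines_def \<phi>_def Om_def line_space_def)
  have af: "affine_part (points_of H) L = \<phi> ` {W \<in> Om. points_of W \<in> L}"
  proof (intro set_eqI iffI)
    fix l assume "l \<in> affine_part (points_of H) L"
    then obtain W where W: "line_space W" "points_of W \<in> L" "\<not> points_of W \<subseteq> points_of H" "l = \<phi> W"
      using L by (fastforce simp: affine_part_def pg_lines_def \<phi>_def line_space_def)
    then have "\<not> W \<subseteq> H" by (auto simp: points_of_def)
    then show "l \<in> \<phi> ` {W \<in> Om. points_of W \<in> L}" using W by (auto simp: Om_def)
  next
    fix l assume "l \<in> \<phi> ` {W \<in> Om. points_of W \<in> L}"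
    then obtain W where W: "line_space W" "\<not> W \<subseteq> H" "points_of W \<in> L" "l = \<phi> W"
      by (auto simp: Om_def)
    then have "\<not> points_of W \<subseteq> points_of H"
      using points_of_subset_iff[of W H] H by (simp add: line_space_def)
    then show "l \<in> affine_part (points_of H) L" using W by (auto simp: affine_part_def \<phi>_def)
  qed
  have pts: "ag_points (points_of H) = {vec.span {v} | v. v \<notin> H}"
  proof -
    have "vec.span {v} \<notin> points_of H \<longleftrightarrow> v \<notin> H" if "v \<noteq> 0" for v
      using span_mem_points_of_iff[OF H that] by simp
    moreover have "v \<noteq> 0" if "v \<notin> H" for v using that vec.subspace_0[OF H] by blast
    ultimately show ?thesis unfolding ag_points_def pg_points_eq by blast
  qed
  have sub: "P \<in> ag_points (points_of H)" if "P \<in> \<phi> W" for P W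
    using that by (auto simp: ag_points_def \<phi>_def points_of_def)
  have spread: "line_spread (ag_points (points_of H)) (ag_lines (points_of H)) (\<phi> ` S) \<longleftrightarrow>
      (\<forall>v. v \<notin> H \<longrightarrow> (\<exists>!W. W \<in> S \<and> v \<in> W))" if S: "S \<subseteq> Om" for S
  proof
    assume "line_spread (ag_points (points_of H)) (ag_lines (points_of H)) (\<phi> ` S)"
    then have un: "\<Union>(\<phi> ` S) = ag_points (points_of H)" and dj: "disjoint (\<phi> ` S)"
      by (auto simp: line_spread_def partition_on_def)
    show "\<forall>v. v \<notin> H \<longrightarrow> (\<exists>!W. W \<in> S \<and> v \<in> W)"
    proof (intro allI impI)
      fix v assume v: "v \<notin> H"
      then have "vec.span {v} \<in> \<Union>(\<phi> ` S)" unfolding un pts by blast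
      then obtain W where W: "W \<in> S" "vec.span {v} \<in> \<phi> W" by blast
      show "\<exists>!W. W \<in> S \<and> v \<in> W"
      proof (rule ex1I[of _ W])
        show "W \<in> S \<and> v \<in> W" using W mem[OF v] S by blast
        fix W' assume W': "W' \<in> S \<and> v \<in> W'"
        then have "vec.span {v} \<in> \<phi> W'" using mem[OF v] S by blast
        then have "\<phi> W = \<phi> W'" using dj W W' by (auto simp: disjoint_def)
        then show "W' = W" using inj W W' S by (auto dest: inj_onD)
      qed
    qed
  next
    assume *: "\<forall>v. v \<notin> H \<longrightarrow> (\<exists>!W. W \<in> S \<and> v \<in> W)"
    have "\<Union>(\<phi> ` S) = ag_points (points_of H)"
    proof (intro set_eqI iffI)
      fix P assume "P \<in> ag_points (points_of H)"
      then obtain v where v: "P = vec.span {v}" "v \<notin> H" unfolding pts by blast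
      then obtain W where "W \<in> S" "v \<in> W" using * by blast
      then show "P \<in> \<Union>(\<phi> ` S)" using v mem S by blast
    qed (use sub in blast)
    moreover have "disjoint (\<phi> ` S)"
    proof (rule disjointI)
      fix l m assume lm: "l \<in> \<phi> ` S" "m \<in> \<phi> ` S" "l \<noteq> m"
      show "l \<inter> m = {}"
      proof (rule ccontr)
        assume "l \<inter> m \<noteq> {}"
        then obtain P where P: "P \<in> l" "P \<in> m" by blast
        obtain W W' where W: "W \<in> S" "W' \<in> S" "l = \<phi> W" "m = \<phi> W'" using lm by blast
        have "P \<in> ag_points (points_of H)" using sub W P by blast
        then obtain v where v: "P = vec.span {v}" "v \<notin> H" unfolding pts by blast
        have "v \<in> W" "v \<in> W'" using v W P mem S by blast+
        then have "W = W'" using * v W by blast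
        then show False using W lm by simp
      qed
    qed
    moreover have "{} \<notin> \<phi> ` S"
    proof
      assume "{} \<in> \<phi> ` S"
      then obtain W where W: "W \<in> S" "\<phi> W = {}" by auto
      then obtain v where "v \<in> W" "v \<notin> H" using S by (auto simp: Om_def)
      then show False using mem W S by blast
    qed
    ultimately show "line_spread (ag_points (points_of H)) (ag_lines (points_of H)) (\<phi> ` S)"
      using S by (auto simp: line_spread_def partition_on_def ag)
  qed
  have card: "card (affine_part (points_of H) L \<inter> \<phi> ` S) = card {W \<in> S. points_of W \<in> L}"
    if S: "S \<subseteq> Om" for S
  proof -
    have "affine_part (points_of H) L \<inter> \<phi> ` S = \<phi> ` ({W \<in> Om. points_of W \<in> L} \<inter> S)"
      unfolding af using S by (intro inj_on_image_Int[OF inj, symmetric]) auto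
    also have "{W \<in> Om. points_of W \<in> L} \<inter> S = {W \<in> S. points_of W \<in> L}" using S by blast
    finally show ?thesis using S by (simp add: card_image inj_on_subset[OF inj] subset_iff)
  qed
  have sp: "(\<exists>S0 \<subseteq> Om. S = \<phi> ` S0)" if "line_spread (ag_points (points_of H)) (ag_lines (points_of H)) S" for S
    using that by (auto simp: line_spread_def ag subset_image_iff)
  have "affine_part (points_of H) L \<subseteq> ag_lines (points_of H)" unfolding ag af by blast
  then have "cameron_liebler (ag_points (points_of H)) (ag_lines (points_of H)) x
           (affine_part (points_of H) L) \<longleftrightarrow> (\<forall>S \<subseteq> Om. line_spread (ag_points (points_of H)) (ag_lines (points_of H)) (\<phi> ` S) \<longrightarrow>
              card (affine_part (points_of H) L \<inter> \<phi> ` S) = x)"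
    using sp unfolding cameron_liebler_def by blast
  also have "\<dots> \<longleftrightarrow> (\<forall>S \<subseteq> Om. (\<forall>v. v \<notin> H \<longrightarrow> (\<exists>!W. W \<in> S \<and> v \<in> W)) \<longrightarrow>
           card {W \<in> S. points_of W \<in> L} = x)"
    by (intro all_cong1 imp_cong refl) (simp_all add: spread card)
  also have "\<dots> \<longleftrightarrow> (\<forall>S. (\<forall>W\<in>S. line_space W \<and> \<not> W \<subseteq> H) \<and> (\<forall>v. v \<notin> H \<longrightarrow> (\<exists>!W. W \<in> S \<and> v \<in> W)) \<longrightarrow>
           card {W \<in> S. points_of W \<in> L} = x)"
    by (auto simp: Om_def subset_iff)
  finally show ?thesis .
qed

lemma line_space_not_subset_zero: "line_space W \<Longrightarrow> \<not> W \<subseteq> {0}"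
  using vec.dim_subset[of W "{0}"] by (auto simp: line_space_def)

text \<open>The case \<open>H = {0}\<close>: no point is at infinity, and every line is its own
  affine part.\<close>

lemma cameron_liebler_pg_iff:
  fixes L :: "('a::{field,finite} ^ 4) set set set"
  assumes L: "L \<subseteq> pg_lines"
  shows "cameron_liebler pg_points pg_lines x L \<longleftrightarrow>
         (\<forall>S. (\<forall>W\<in>S. line_space W) \<and> (\<forall>v. v \<noteq> 0 \<longrightarrow> (\<exists>!W. W \<in> S \<and> v \<in> W)) \<longrightarrow>
           card {W \<in> S. points_of W \<in> L} = x)"
proof -
  have ne: "{} \<notin> (pg_lines :: ('a ^ 4) set set set)"
  proof
    assume "{} \<in> (pg_lines :: ('a ^ 4) set set set)"
    then obtain W :: "('a ^ 4) set" where "line_space W" "points_of W = {}"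
      by (auto simp: pg_lines_def line_space_def)
    then show False
      using points_of_subset_iff[of W "{0}"] line_space_not_subset_zero[of W]
      by (auto simp: line_space_def vec.subspace_single_0)
  qed
  have "affine_part {} M = M" if "M \<subseteq> pg_lines" for M :: "('a ^ 4) set set set"
    using that ne by (auto simp: affine_part_def)
  then show ?thesis
    using cameron_liebler_iff[OF vec.subspace_single_0 L, of x] L
    by (simp add: points_of_zero ag_lines_def ag_points_def line_space_not_subset_zero
        del: subset_singleton_iff cong: conj_cong)
qed

section \<open>Sums over the vectors of a subspace\<close>

text \<open>The decomposition \<open>a *s b + u\<close> is unique because \<open>b\<close> is
  outside the span. A constant \<open>f\<close> yields the number of vectors; \<open>B = {}\<close>
  yields the sum over the multiples of one vector.\<close>

lemma sum_span_insert:
  fixes b :: "'a::{field,finite} ^ 'n" and f :: "'a ^ 'n \<Rightarrow> 'b::comm_monoid_add"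
  assumes "b \<notin> vec.span B"
  shows "(\<Sum>v\<in>vec.span (insert b B). f v) = (\<Sum>a\<in>UNIV. \<Sum>u\<in>vec.span B. f (a *s b + u))"
proof -
  let ?g = "\<lambda>(a, u). a *s b + u"
  have "inj_on ?g (UNIV \<times> vec.span B)"
  proof (rule inj_onI, clarify)
    fix a u a' u'
    assume *: "u \<in> vec.span B" "u' \<in> vec.span B" "a *s b + u = a' *s b + u'"
    have "(a - a') *s b = u' - u" using *(3) by (simp add: vec.scale_left_diff_distrib algebra_simps)
    then have "(a - a') *s b \<in> vec.span B" using * by (simp add: vec.span_diff)
    then have "a - a' = 0" using assms vec.span_scale[of "(a - a') *s b" B "inverse (a - a')"]
      by (cases "a - a' = 0") auto
    then show "a = a' \<and> u = u'" using *(3) by simp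
  qed
  moreover have "?g ` (UNIV \<times> vec.span B) = vec.span (insert b B)"
  proof (intro set_eqI iffI)
    fix v assume "v \<in> vec.span (insert b B)"
    then obtain a where "v - a *s b \<in> vec.span B" by (auto simp: vec.span_insert)
    then show "v \<in> ?g ` (UNIV \<times> vec.span B)"
      by (intro image_eqI[of _ _ "(a, v - a *s b)"]) auto
  next
    fix v assume "v \<in> ?g ` (UNIV \<times> vec.span B)"
    then obtain a u where "v = a *s b + u" "u \<in> vec.span B" by auto
    then have "v - a *s b \<in> vec.span B" by simp
    then show "v \<in> vec.span (insert b B)" unfolding vec.span_insert by blast
  qed
  ultimately have "bij_betw ?g (UNIV \<times> vec.span B) (vec.span (insert b B))"
    by (simp add: bij_betw_def)
  from sum.reindex_bij_betw[OF this, of f] show ?thesis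
    by (simp add: sum.cartesian_product case_prod_unfold)
qed

lemma card_vec_subspace:
  fixes W :: "('a::{field,finite} ^ 'n) set"
  assumes "vec.subspace W"
  shows "card W = CARD('a) ^ vec.dim W"
proof -
  have "card (vec.span B) = CARD('a) ^ card B" if "finite B" "vec.independent B" for B :: "('a ^ 'n) set"
    using that
  proof (induction B)
    case (insert b B)
    then have "b \<notin> vec.span B" by (simp add: vec.independent_insert split: if_splits)
    from sum_span_insert[OF this, of "\<lambda>_. 1 :: nat"] insert show ?case
      by (simp add: vec.independent_insert)
  qed simp
  moreover obtain B where "B \<subseteq> W" "vec.independent B" "W \<subseteq> vec.span B" "card B = vec.dim W"
    using vec.basis_exists[of W] by metis
  moreover from this have "vec.span B = W" using assms by (metis subset_antisym vec.span_minimal)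
  ultimately show ?thesis by (metis finite_code)
qed

section \<open>Regular spreads through a line\<close>

text \<open>
  A monic quadratic with a root splits; as \<open>(r, s) \<mapsto> (r + s, r s)\<close> identifies \<open>(0, 1)\<close> and
  \<open>(1, 0)\<close>, it is not onto, so some monic quadratic has no root.
\<close>

lemma ex_anisotropic_quadratic_form:
  obtains u v :: "'a::{field,finite}"
  where "\<And>x y. x * x + u * x * y - v * y * y = 0 \<Longrightarrow> x = 0 \<and> y = 0"
proof -
  let ?h = "\<lambda>(r, s). (r + s, r * s) :: 'a \<times> 'a"
  have "\<not> inj ?h"
  proof
    assume "inj ?h"
    from injD[OF this, of "(0, 1)" "(1, 0)"] show False by simp
  qed
  then have "\<not> surj ?h" using finite_UNIV_surj_inj[of ?h] by auto
  then obtain p where "p \<notin> range ?h" by blast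
  moreover obtain m n where "p = (m, n)" by (cases p)
  ultimately have mn: "(m, n) \<noteq> ?h (r, s)" for r s by blast
  \<comment> \<open>A root \<open>t\<close> would have the partner \<open>m - t\<close>, making
    \<open>(m, n)\<close> equal to \<open>?h (t, m - t)\<close>.\<close>
  have noroot: "t * t - m * t + n \<noteq> 0" for t
    using mn[of t "m - t"] by (auto simp: algebra_simps)
  show thesis
  proof (rule that[of "- m" "- n"])
    fix x y assume *: "x * x + - m * x * y - - n * y * y = 0"
    have "y = 0"
    proof (rule ccontr)
      assume "y \<noteq> 0"
      then have "(x / y) * (x / y) - m * (x / y) + n = (x * x + - m * x * y - - n * y * y) / (y * y)"
        by (simp add: field_simps)
      then show False unfolding * using noroot[of "x / y"] by (simp only: div_0)
    qed
    then show "x = 0 \<and> y = 0" using * by simp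
  qed
qed

lemma line_space_span:
  assumes "v \<noteq> 0" "w \<notin> vec.span {v}"
  shows "line_space (vec.span {v, w})"
proof -
  have "vec.independent {w, v}" using assms by (simp add: vec.independent_insert)
  moreover have "v \<noteq> w" using assms vec.span_base[of v "{v}"] by auto
  ultimately show ?thesis
    using vec.dim_eq_card_independent[of "{w, v}"] by (simp add: line_space_def insert_commute)
qed

lemma line_space_eq_span:
  assumes W: "line_space W" "v \<in> W" "w \<in> W" and "v \<noteq> 0" "w \<notin> vec.span {v}"
  shows "W = vec.span {v, w}"
proof -
  have "vec.span {v, w} \<subseteq> W" using W by (intro vec.span_minimal) (auto simp: line_space_def)
  then show ?thesis
    using W(1) line_space_span[OF assms(4,5)]
    by (intro vec.subspace_dim_equal[symmetric]) (auto simp: line_space_def)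
qed

lemma line_space_frame:
  assumes "line_space W"
  obtains e1 e2 e3 e4 :: "'a::{field,finite} ^ 4"
  where "bij (\<lambda>(a, b, c, d). a *s e1 + b *s e2 + c *s e3 + d *s e4)"
    and "W = {c *s e3 + d *s e4 | c d. True}"
proof -
  obtain B where B: "B \<subseteq> W" "vec.independent B" "W \<subseteq> vec.span B" "card B = 2"
    using vec.basis_exists[of W] assms unfolding line_space_def by metis
  obtain e3 e4 where e34: "B = {e3, e4}" using B(4) by (auto simp: card_2_iff)
  have W: "W = vec.span {e3, e4}"
    using B(1,3) assms by (metis e34 line_space_def subset_antisym vec.span_minimal)
  obtain C where C: "B \<subseteq> C" "vec.independent C" "UNIV \<subseteq> vec.span C"
    using vec.maximal_independent_subset_extend[of B UNIV] B(2) by auto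
  have "card C = vec.dim (UNIV :: ('a ^ 4) set)"
    using C by (intro vec.basis_card_eq_dim) auto
  also have "\<dots> = 4" by (simp only: vec_dim_card) simp
  finally have "card (C - B) = 2" using C(1) B(4) by (simp add: card_Diff_subset)
  then obtain e1 e2 where e12: "C - B = {e1, e2}" by (auto simp: card_2_iff)
  have C': "C = {e1, e2, e3, e4}" using e12 e34 C(1) by blast
  let ?E = "\<lambda>(a, b, c, d). a *s e1 + b *s e2 + c *s e3 + d *s e4"
  have "surj ?E"
    unfolding surj_def
  proof
    fix v
    have "v \<in> vec.span {e1, e2, e3, e4}" using C(3) C' by blast
    then obtain a b c d where "v - a *s e1 - b *s e2 - c *s e3 - d *s e4 = 0"
      unfolding vec.span_insert by auto
    then show "\<exists>z. v = ?E z" by (intro exI[of _ "(a, b, c, d)"]) (simp add: algebra_simps)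
  qed
  \<comment> \<open>Both sides have q^4 elements, so surjectivity suffices.\<close>
  moreover have "inj ?E"
    using \<open>surj ?E\<close>
    by (intro eq_card_imp_inj_on) (simp_all add: numeral_eq_Suc)
  moreover have "W = {c *s e3 + d *s e4 | c d. True}"
  proof (intro set_eqI iffI)
    fix v assume "v \<in> W"
    then obtain c d where "v - c *s e3 - d *s e4 = 0" unfolding W vec.span_insert by auto
    then have "v = c *s e3 + d *s e4" by (simp add: algebra_simps)
    then show "v \<in> {c *s e3 + d *s e4 | c d. True}" by blast
  next
    fix v assume "v \<in> {c *s e3 + d *s e4 | c d. True}"
    moreover have "c *s e3 + d *s e4 \<in> vec.span {e3, e4}" for c d
      by (intro vec.span_add vec.span_scale vec.span_base) simp_all
    ultimately show "v \<in> W" unfolding W by blast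
  qed
  ultimately show thesis by (intro that) (auto simp: bij_def)
qed

text \<open>
  In a frame \<open>e1, e2, e3, e4\<close> with \<open>W = \<langle>e3, e4\<rangle>\<close> the lines skew to \<open>W\<close> are the graphs of the
  \<open>2 \<times> 2\<close> matrices \<open>B\<close>. The matrices \<open>M (s, t)\<close> form a copy of the field with \<open>q\<^sup>2\<close> elements, so
  differences of distinct ones are invertible and every translate \<open>B + M\<close> yields a spread through \<open>W\<close>.
\<close>

lemma spreads_through_line:
  fixes W :: "('a::{field,finite} ^ 4) set"
  assumes W: "line_space W"
  obtains G :: "'a \<times> 'a \<times> 'a \<times> 'a \<Rightarrow> ('a ^ 4) set" and M :: "'a \<times> 'a \<Rightarrow> 'a \<times> 'a \<times> 'a \<times> 'a"
  where "bij_betw G UNIV {U. line_space U \<and> W \<inter> U = {0}}"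
    and "inj M"
    and "\<And>B v. v \<noteq> 0 \<Longrightarrow> \<exists>!U. U \<in> insert W (range (\<lambda>z. G (B + M z))) \<and> v \<in> U"
proof -
  obtain e1 e2 e3 e4 :: "'a ^ 4"
    where bij: "bij (\<lambda>(a, b, c, d). a *s e1 + b *s e2 + c *s e3 + d *s e4)"
      and We: "W = {c *s e3 + d *s e4 | c d. True}"
    using line_space_frame[OF W] by blast
  obtain u v :: 'a where uv: "\<And>x y. x * x + u * x * y - v * y * y = 0 \<Longrightarrow> x = 0 \<and> y = 0"
    using ex_anisotropic_quadratic_form by blast
  define E where "E = (\<lambda>a b c d. a *s e1 + b *s e2 + c *s e3 + d *s e4)"
  have E_eq: "E a b c d = E a' b' c' d' \<longleftrightarrow> a = a' \<and> b = b' \<and> c = c' \<and> d = d'" for a b c d a' b' c' d'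
    using bij_is_inj[OF bij] by (auto simp: E_def dest: injD[where x = "(a, b, c, d)" and y = "(a', b', c', d')"])
  have E_ex: "\<exists>a b c d. w = E a b c d" for w
    using bij_is_surj[OF bij] unfolding surj_def E_def by (metis (no_types, lifting) case_prod_conv surj_pair)
  have E_add: "E a b c d + E a' b' c' d' = E (a + a') (b + b') (c + c') (d + d')" for a b c d a' b' c' d'
    by (simp add: E_def vec.scale_left_distrib algebra_simps)
  have E_scale: "k *s E a b c d = E (k * a) (k * b) (k * c) (k * d)" for k a b c d
    by (simp add: E_def vec.scale_right_distrib)
  have E_0: "E 0 0 0 0 = 0" by (simp add: E_def)
  have E_W: "E a b c d \<in> W \<longleftrightarrow> a = 0 \<and> b = 0" for a b c d
  proof -
    have "W = {E 0 0 c d | c d. True}" unfolding We E_def by simp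
    then show ?thesis by (auto simp: E_eq)
  qed
  \<comment> \<open>The graph of the matrix with rows \<open>(a, b)\<close> and
    \<open>(c, d)\<close>, acting on row vectors \<open>(x, y)\<close> from the right.\<close>
  define G where "G = (\<lambda>(a, b, c, d). {E x y (x * a + y * c) (x * b + y * d) | x y. True})"
  have E_G: "E x y z w \<in> G (a, b, c, d) \<longleftrightarrow> z = x * a + y * c \<and> w = x * b + y * d" for x y z w a b c d
    by (auto simp: G_def E_eq)
  have G_span: "G (a, b, c, d) = vec.span {E 1 0 a b, E 0 1 c d}" for a b c d
  proof -
    have "w \<in> vec.span {E 1 0 a b, E 0 1 c d} \<longleftrightarrow> (\<exists>x y. w = x *s E 1 0 a b + y *s E 0 1 c d)" for w
      by (simp add: vec.span_insert diff_eq_eq add.commute)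
    then show ?thesis by (auto simp: G_def E_scale E_add)
  qed
  have G_line: "line_space (G B)" for B
  proof -
    obtain a b c d where B: "B = (a, b, c, d)" by (metis surj_pair)
    have "E 0 1 c d \<noteq> 0" using E_eq[of 0 1 c d 0 0 0 0] E_0 by simp
    moreover have "E 1 0 a b \<notin> vec.span {E 0 1 c d}"
      by (auto simp: vec.span_singleton E_scale E_eq)
    ultimately show ?thesis
      using line_space_span[of "E 0 1 c d" "E 1 0 a b"] by (simp add: B G_span insert_commute)
  qed
  have G_W: "W \<inter> G B = {0}" for B
  proof -
    obtain a b c d where B: "B = (a, b, c, d)" by (metis surj_pair)
    have "w = 0" if "w \<in> W" "w \<in> G B" for w
    proof -
      obtain x y z t where w: "w = E x y z t" using E_ex by blast
      show ?thesis using that unfolding w B by (simp add: E_W E_G E_0)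
    qed
    moreover have "0 \<in> W" "0 \<in> G B" using E_W[of 0 0 0 0] E_G[of 0 0 0 0] by (simp_all add: E_0 B)
    ultimately show ?thesis by blast
  qed
  have inj: "inj G"
  proof (rule injI)
    fix B B' assume eq: "G B = G B'"
    obtain a b c d where B: "B = (a, b, c, d)" by (metis surj_pair)
    have "E 1 0 a b \<in> G B" "E 0 1 c d \<in> G B" by (simp_all add: B E_G)
    then show "B = B'" unfolding eq by (cases B') (simp add: B E_G)
  qed
  \<comment> \<open>By the dimension formula \<open>W\<close> and \<open>U\<close> together span
    everything, so \<open>U\<close> projects onto the first two coordinates. Its vectors above
    \<open>(1, 0)\<close> and \<open>(0, 1)\<close> supply the two rows of the matrix.\<close>
  have surj: "U \<in> range G" if U: "line_space U" "W \<inter> U = {0}" for U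
  proof -
    have "vec.dim {x + y | x y. x \<in> W \<and> y \<in> U} + vec.dim (W \<inter> U) = vec.dim W + vec.dim U"
      using W U(1) by (intro vec.dim_sums_Int) (simp_all add: line_space_def)
    then have "vec.dim {x + y | x y. x \<in> W \<and> y \<in> U} = 4"
      using W U by (simp add: line_space_def)
    moreover have "vec.subspace {x + y | x y. x \<in> W \<and> y \<in> U}"
      using W U(1) by (intro vec.subspace_sums) (simp_all add: line_space_def)
    ultimately have "{x + y | x y. x \<in> W \<and> y \<in> U} = UNIV"
      by (intro vec.subspace_dim_equal) (simp_all only: vec_dim_card, simp_all)
    then have ex: "\<exists>x y. w = x + y \<and> x \<in> W \<and> y \<in> U" for w by blast
    have proj: "\<exists>c d. E a b c d \<in> U" for a b
    proof -
      obtain w y where w: "E a b 0 0 = w + y" "w \<in> W" "y \<in> U" using ex by blast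
      obtain a' b' c d where y: "y = E a' b' c d" using E_ex by blast
      obtain a'' b'' c'' d'' where "w = E a'' b'' c'' d''" using E_ex by blast
      then show ?thesis using w by (auto simp: y E_W E_add E_eq)
    qed
    obtain a b c d where U': "E 1 0 a b \<in> U" "E 0 1 c d \<in> U" using proj by meson
    then have "G (a, b, c, d) \<subseteq> U" unfolding G_span
      using U(1) by (intro vec.span_minimal) (auto simp: line_space_def)
    then have "G (a, b, c, d) = U"
      using U(1) G_line by (intro vec.subspace_dim_equal) (auto simp: line_space_def)
    then show ?thesis by blast
  qed
  \<comment> \<open>\<open>M (s, t)\<close> is s I + t C, where C has rows \<open>(0, 1)\<close> and
    \<open>(v, u)\<close>. Its determinant is the anisotropic form at \<open>(s, t)\<close>, hence
    nonzero unless s = t = 0.\<close>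
  define M where "M = (\<lambda>(s, t). (s, t, v * t, s + u * t))"
  show thesis
  proof (rule that[of G M])
    show "bij_betw G UNIV {U. line_space U \<and> W \<inter> U = {0}}"
    proof -
      have "range G \<subseteq> {U. line_space U \<and> W \<inter> U = {0}}" using G_line G_W by blast
      moreover have "{U. line_space U \<and> W \<inter> U = {0}} \<subseteq> range G" using surj by blast
      ultimately show ?thesis unfolding bij_betw_def using inj by (intro conjI subset_antisym)
    qed
    show "inj M" by (auto simp: inj_def M_def)
    fix B :: "'a \<times> 'a \<times> 'a \<times> 'a" and w :: "'a ^ 4" assume w0: "w \<noteq> 0"
    obtain a b c d where B: "B = (a, b, c, d)" by (metis surj_pair)
    obtain x y z t where w: "w = E x y z t" using E_ex by blast
    show "\<exists>!U. U \<in> insert W (range (\<lambda>z. G (B + M z))) \<and> w \<in> U"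
    proof (cases "x = 0 \<and> y = 0")
      case True
      then have "w \<in> W" by (simp add: w E_W)
      moreover have "w \<notin> G B'" for B' using \<open>w \<in> W\<close> w0 G_W[of B'] by blast
      ultimately show ?thesis by (intro ex1I[of _ W]) blast+
    next
      case False
      \<comment> \<open>\<open>p\<close> and \<open>r\<close> are what remains of the last two
        coordinates after subtracting the image of \<open>(x, y)\<close> under \<open>B\<close>.
        Membership is then a linear system in \<sigma> and \<tau> whose determinant is
        \<open>D\<close>, the same form at \<open>(x, y)\<close>; the solution below is Cramer's
        rule.\<close>
      define D where "D = x * x + u * x * y - v * y * y"
      define p r where "p = z - x * a - y * c" and "r = t - x * b - y * d"
      have D: "D \<noteq> 0" using False uv unfolding D_def by blast
      have mem: "w \<in> G (B + M (\<sigma>, \<tau>)) \<longleftrightarrow>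
          \<sigma> = (p * (x + u * y) - v * y * r) / D \<and> \<tau> = (x * r - y * p) / D" for \<sigma> \<tau>
      proof -
        have "w \<in> G (B + M (\<sigma>, \<tau>)) \<longleftrightarrow> x * \<sigma> + v * y * \<tau> = p \<and> y * \<sigma> + (x + u * y) * \<tau> = r"
          by (simp add: w B M_def E_G p_def r_def) (auto simp: algebra_simps)
        also have "\<dots> \<longleftrightarrow> \<sigma> * D = p * (x + u * y) - v * y * r \<and> \<tau> * D = x * r - y * p"
        proof (intro iffI conjI; elim conjE)
          assume *: "\<sigma> * D = p * (x + u * y) - v * y * r" "\<tau> * D = x * r - y * p"
          have "(x * \<sigma> + v * y * \<tau>) * D = x * (\<sigma> * D) + v * y * (\<tau> * D)"
            by (simp add: algebra_simps)
          also have "\<dots> = p * D" unfolding * by (simp add: D_def algebra_simps)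
          finally show "x * \<sigma> + v * y * \<tau> = p" using D by simp
          have "(y * \<sigma> + (x + u * y) * \<tau>) * D = y * (\<sigma> * D) + (x + u * y) * (\<tau> * D)"
            by (simp add: algebra_simps)
          also have "\<dots> = r * D" unfolding * by (simp add: D_def algebra_simps)
          finally show "y * \<sigma> + (x + u * y) * \<tau> = r" using D by simp
        qed (auto simp: D_def algebra_simps)
        finally show ?thesis using D by (simp add: eq_divide_eq)
      qed
      have "w \<notin> W" using False by (simp add: w E_W)
      then show ?thesis
        using mem
        by (intro ex1I[of _ "G (B + M ((p * (x + u * y) - v * y * r) / D, (x * r - y * p) / D))"]) auto
    qed
  qed
qed

text \<open>The translate at \<open>B = 0\<close>. \<open>W\<close> is kept apart from
  \<open>S\<close> because one direction of the theorem removes it from the spread.\<close>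

lemma spread_through_line:
  fixes W :: "('a::{field,finite} ^ 4) set"
  assumes W: "line_space W"
  obtains S where "\<And>U. U \<in> S \<Longrightarrow> line_space U \<and> W \<inter> U = {0}"
    and "\<And>v. v \<noteq> 0 \<Longrightarrow> \<exists>!U. U \<in> insert W S \<and> v \<in> U"
proof -
  obtain G and M :: "'a \<times> 'a \<Rightarrow> 'a \<times> 'a \<times> 'a \<times> 'a"
    where G: "bij_betw G UNIV {U. line_space U \<and> W \<inter> U = {0}}" and "inj M"
      and cover: "\<And>B v. v \<noteq> 0 \<Longrightarrow> \<exists>!U. U \<in> insert W (range (\<lambda>z. G (B + M z))) \<and> v \<in> U"
    using spreads_through_line[OF W] by blast
  show thesis
  proof (rule that)
    show "line_space U \<and> W \<inter> U = {0}" if "U \<in> range (\<lambda>z. G (0 + M z))" for U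
      using that G by (auto simp: bij_betw_def)
  qed (rule cover)
qed

section \<open>Lines of the class skew to a given line\<close>

text \<open>A skew line lies in exactly q^2 of the q^4 spreads, one for each \<open>z\<close>, since
  its matrix is \<open>B + M z\<close> for a unique \<open>B\<close>. Adding up over all
  \<open>B\<close> the lines of the class other than \<open>W\<close> therefore counts each wanted
  line q^2 times.\<close>

lemma card_skew_lines:
  fixes W :: "('a::{field,finite} ^ 4) set" and P :: "('a ^ 4) set \<Rightarrow> bool"
  assumes W: "line_space W"
    and spread: "\<And>S. \<forall>U\<in>S. line_space U \<Longrightarrow> \<forall>v. v \<noteq> 0 \<longrightarrow> (\<exists>!U. U \<in> S \<and> v \<in> U) \<Longrightarrow>
      card {U \<in> S. P U} = x"
  shows "real (card {U. line_space U \<and> W \<inter> U = {0} \<and> P U}) =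
    real CARD('a) ^ 2 * (real x - of_bool (P W))"
proof -
  let ?q = "real CARD('a)"
  let ?skew = "{U. line_space U \<and> W \<inter> U = {0}}"
  obtain G and M :: "'a \<times> 'a \<Rightarrow> 'a \<times> 'a \<times> 'a \<times> 'a"
    where G: "bij_betw G UNIV ?skew" and M: "inj M"
      and cover: "\<And>B v. v \<noteq> 0 \<Longrightarrow> \<exists>!U. U \<in> insert W (range (\<lambda>z. G (B + M z))) \<and> v \<in> U"
    using spreads_through_line[OF W] by blast
  have Gmem: "G B \<in> ?skew" for B using G by (auto simp: bij_betw_def)
  have W_notin: "W \<noteq> G B" for B
    using Gmem[of B] line_space_not_subset_zero[OF W] by auto
  \<comment> \<open>The q^2 graphs of one translate are distinct from each other and from
    \<open>W\<close>, so nothing is counted twice.\<close>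
  have translate: "real x = of_bool (P W) + (\<Sum>z\<in>UNIV. of_bool (P (G (B + M z))))" for B
  proof -
    let ?S = "insert W (range (\<lambda>z. G (B + M z)))"
    have inj: "inj (\<lambda>z. G (B + M z))"
      using bij_betw_imp_inj_on[OF G] M by (intro injI) (blast dest: injD add_left_imp_eq)
    have "card {U \<in> ?S. P U} = x"
      using W Gmem cover by (intro spread) auto
    then have "real x = (\<Sum>U\<in>?S. of_bool (P U))"
      by (simp add: sum.If_cases of_bool_def Int_def)
    also have "\<dots> = of_bool (P W) + (\<Sum>U\<in>range (\<lambda>z. G (B + M z)). of_bool (P U))"
    proof -
      have "W \<notin> range (\<lambda>z. G (B + M z))" using W_notin by blast
      then show ?thesis by (rule sum.insert[OF finite])
    qed
    also have "(\<Sum>U\<in>range (\<lambda>z. G (B + M z)). of_bool (P U)) = (\<Sum>z\<in>UNIV. of_bool (P (G (B + M z))) :: real)"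
      by (subst sum.reindex[OF inj]) simp
    finally show ?thesis .
  qed
  \<comment> \<open>For a fixed matrix \<open>C\<close> the shift by \<open>C\<close> permutes all
    matrices, so every \<open>z\<close> contributes the same number.\<close>
  have shift: "(\<Sum>B\<in>UNIV. of_bool (P (G (B + C)))) = real (card {U \<in> ?skew. P U})" for C
  proof -
    have "(\<Sum>B\<in>UNIV. of_bool (P (G (B + C)))) = (\<Sum>B\<in>UNIV. of_bool (P (G B)) :: real)"
      by (rule sum.reindex_bij_witness[of _ "\<lambda>B. B - C" "\<lambda>B. B + C"]) auto
    also have "\<dots> = (\<Sum>U\<in>?skew. of_bool (P U))"
      by (rule sum.reindex_bij_betw[OF G])
    finally show ?thesis by (simp add: sum.If_cases of_bool_def Int_def)
  qed
  have "?q ^ 4 * real x = (\<Sum>B\<in>(UNIV :: ('a \<times> 'a \<times> 'a \<times> 'a) set). real x)"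
    by (simp add: power4_eq_xxxx)
  also have "\<dots> = (\<Sum>B\<in>UNIV. of_bool (P W) + (\<Sum>z\<in>UNIV. of_bool (P (G (B + M z)))))"
    using translate by (rule sum.cong[OF refl])
  also have "\<dots> = ?q ^ 4 * of_bool (P W) + (\<Sum>z\<in>UNIV. \<Sum>B\<in>UNIV. of_bool (P (G (B + M z))))"
    by (subst sum.swap) (simp add: sum.distrib power4_eq_xxxx)
  also have "\<dots> = ?q ^ 4 * of_bool (P W) + ?q ^ 2 * real (card {U \<in> ?skew. P U})"
    by (simp add: shift power2_eq_square)
  finally have "?q ^ 2 * real (card {U \<in> ?skew. P U}) = ?q ^ 2 * (?q ^ 2 * (real x - of_bool (P W)))"
    by (simp add: algebra_simps power4_eq_xxxx power2_eq_square)
  moreover have "?q ^ 2 \<noteq> 0" by simp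
  ultimately have "real (card {U \<in> ?skew. P U}) = ?q ^ 2 * (real x - of_bool (P W))"
    by (rule mult_left_cancel[THEN iffD1, rotated])
  then show ?thesis by (simp only: mem_Collect_eq conj_assoc)
qed

section \<open>Point weights of a line class\<close>

lemma card_field_gt_1: "real CARD('a::{field,finite}) > 1"
proof -
  have "card {0, 1 :: 'a} \<le> CARD('a)" by (rule card_mono) simp_all
  then show ?thesis by simp
qed

text \<open>Equal, meeting and skew lines share q^2, q and 1 vectors. The three cases are merged
  into one formula with indicators so that it can be summed over a line class.\<close>

lemma card_line_Int:
  fixes W U :: "('a::{field,finite} ^ 4) set"
  assumes "line_space W" "line_space U"
  shows "real (card (W \<inter> U)) = real CARD('a)
    + (real CARD('a) ^ 2 - real CARD('a)) * of_bool (U = W) - (real CARD('a) - 1) * of_bool (W \<inter> U = {0})"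
proof -
  have sub: "vec.subspace W" "vec.subspace U" "vec.subspace (W \<inter> U)" "vec.dim W = 2" "vec.dim U = 2"
    using assms by (auto simp: line_space_def vec.subspace_inter)
  have "vec.dim (W \<inter> U) \<le> 2" using vec.dim_subset[of "W \<inter> U" W] sub by simp
  then consider "vec.dim (W \<inter> U) = 0" | "vec.dim (W \<inter> U) = 1" | "vec.dim (W \<inter> U) = 2" by linarith
  then show ?thesis
  proof cases
    case 1
    then have "W \<inter> U = {0}" using vec.subspace_0[OF sub(3)] by auto
    moreover from this have "U \<noteq> W" using line_space_not_subset_zero[OF assms(1)] by auto
    ultimately show ?thesis by simp
  next
    case 2
    then have "W \<inter> U \<noteq> {0}" by auto
    moreover have "U \<noteq> W" using 2 sub by auto
    ultimately show ?thesis using 2 card_vec_subspace[OF sub(3)] by simp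
  next
    case 3
    then have "W \<inter> U = W" using sub by (intro vec.subspace_dim_equal) simp_all
    moreover have "W \<inter> U = U" using 3 sub by (intro vec.subspace_dim_equal) simp_all
    ultimately have "W = U" by blast
    moreover from this have "W \<inter> U \<noteq> {0}" using line_space_not_subset_zero[OF assms(1)] by auto
    ultimately show ?thesis using 3 sub card_vec_subspace[OF sub(3)] by simp
  qed
qed

text \<open>The classical fact that the characteristic vector of a Cameron-Liebler class lies in the
  row space of the point-line incidence matrix. The coefficient of a point is shared equally by its
  q - 1 nonzero vectors.\<close>

lemma line_class_weights:
  fixes P :: "('a::{field,finite} ^ 4) set \<Rightarrow> bool"
  assumes spread: "\<And>S. \<forall>U\<in>S. line_space U \<Longrightarrow> \<forall>v. v \<noteq> 0 \<longrightarrow> (\<exists>!U. U \<in> S \<and> v \<in> U) \<Longrightarrow>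
      card {U \<in> S. P U} = x"
  obtains f :: "'a ^ 4 \<Rightarrow> real" where "f 0 = 0" "\<And>k v. k \<noteq> 0 \<Longrightarrow> f (k *s v) = f v"
    "\<And>W. line_space W \<Longrightarrow> (\<Sum>v\<in>W. f v) = of_bool (P W)"
proof -
  let ?q = "real CARD('a)"
  define LL where "LL = {U. line_space U \<and> P U}"
  define s where "s = (\<lambda>v. real (card {U \<in> LL. v \<in> U}))"
  \<comment> \<open>Chosen to cancel the constant part: over the q^2 - 1 nonzero vectors of a line
    \<open>W\<close>, \<open>s\<close> sums to (q - 1) (|LL| - q^2 x) plus N if \<open>P W\<close>.
    The zero vector lies on every line and has been taken out with \<open>s 0\<close> =
    |LL|.\<close>
  define c where "c = (?q ^ 2 * real x - real (card LL)) / (?q + 1)"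
  \<comment> \<open>The surplus of a line \<open>W\<close> of the class: q^2 - q because
    \<open>W\<close> shares q^2 vectors with itself instead of q, and (q - 1) q^2 from the indicator
    in the skew-line count.\<close>
  define N where "N = (?q ^ 2 - ?q) * (?q + 1)"
  define f where "f = (\<lambda>v. if v = 0 then 0 else (s v + c) / N)"
  have q: "?q > 1" by (rule card_field_gt_1)
  have N: "N > 0" using q by (simp add: N_def power2_eq_square)
  have sum_s: "(\<Sum>v\<in>W. s v) = ?q * real (card LL) - (?q - 1) * ?q ^ 2 * real x + N * of_bool (P W)"
    if W: "line_space W" for W
  proof -
    have "(\<Sum>v\<in>W. s v) = (\<Sum>v\<in>W. \<Sum>U\<in>LL. of_bool (v \<in> U))"
      by (simp add: s_def of_bool_def sum.If_cases Int_def)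
    also have "\<dots> = (\<Sum>U\<in>LL. \<Sum>v\<in>W. of_bool (v \<in> U))" by (rule sum.swap)
    also have "\<dots> = (\<Sum>U\<in>LL. real (card (W \<inter> U)))" by (simp add: of_bool_def sum.If_cases)
    also have "\<dots> = (\<Sum>U\<in>LL. ?q + (?q ^ 2 - ?q) * of_bool (U = W) - (?q - 1) * of_bool (W \<inter> U = {0}))"
      using W by (intro sum.cong refl card_line_Int) (simp_all add: LL_def)
    also have "\<dots> = ?q * real (card LL) + (?q ^ 2 - ?q) * (\<Sum>U\<in>LL. of_bool (U = W))
        - (?q - 1) * (\<Sum>U\<in>LL. of_bool (W \<inter> U = {0}))"
      by (simp add: sum.distrib sum_subtractf sum_distrib_left)
    also have "(\<Sum>U\<in>LL. of_bool (U = W)) = (of_bool (P W) :: real)"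
      using W by (simp add: of_bool_def sum.If_cases Int_def LL_def)
    also have "(\<Sum>U\<in>LL. of_bool (W \<inter> U = {0})) = real (card {U. line_space U \<and> W \<inter> U = {0} \<and> P U})"
      by (simp add: of_bool_def sum.If_cases Int_def LL_def conj_ac)
    also have "\<dots> = ?q ^ 2 * (real x - of_bool (P W))" using card_skew_lines[OF W spread] .
    finally show ?thesis by (simp add: N_def algebra_simps power2_eq_square)
  qed
  show thesis
  proof (rule that[of f])
    show "f 0 = 0" by (simp add: f_def)
    show "f (k *s v) = f v" if "k \<noteq> 0" for k v
    proof -
      have "k *s v \<in> U \<longleftrightarrow> v \<in> U" if "U \<in> LL" for U
      proof -
        have U: "vec.subspace U" using that by (simp add: LL_def line_space_def)
        have "inverse k *s (k *s v) = v" using \<open>k \<noteq> 0\<close> by simp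
        then show ?thesis using vec.subspace_scale[OF U] by metis
      qed
      then have "{U \<in> LL. k *s v \<in> U} = {U \<in> LL. v \<in> U}" by blast
      then show ?thesis using that by (simp add: f_def s_def)
    qed
    show "(\<Sum>v\<in>W. f v) = of_bool (P W)" if W: "line_space W" for W
    proof -
      have sub: "vec.subspace W" "vec.dim W = 2" using W by (auto simp: line_space_def)
      have 0: "0 \<in> W" using vec.subspace_0[OF sub(1)] .
      have "s 0 = real (card LL)"
      proof -
        have "{U \<in> LL. 0 \<in> U} = LL" by (auto simp: LL_def line_space_def vec.subspace_0)
        then show ?thesis by (simp add: s_def)
      qed
      then have "(\<Sum>v\<in>W - {0}. s v + c) = (\<Sum>v\<in>W. s v) - real (card LL) + (?q ^ 2 - 1) * c"
        using 0 card_vec_subspace[OF sub(1)] sub(2) q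
        by (simp add: sum.distrib sum_diff1 card_Diff_singleton of_nat_diff)
      also have "(?q ^ 2 - 1) * c = (?q - 1) * (?q ^ 2 * real x - real (card LL))"
        using q by (simp add: c_def divide_simps) (simp add: algebra_simps power2_eq_square)
      finally have eq: "(\<Sum>v\<in>W - {0}. s v + c) = N * of_bool (P W)"
        by (simp add: sum_s[OF W] algebra_simps)
      have "(\<Sum>v\<in>W. f v) = (\<Sum>v\<in>W - {0}. f v)"
        using 0 by (simp add: sum.remove[of W 0] f_def)
      also have "\<dots> = (\<Sum>v\<in>W - {0}. s v + c) / N"
        by (simp add: f_def sum_divide_distrib)
      finally show ?thesis using N eq by simp
    qed
  qed
qed

section \<open>Vanishing of the weights at infinity\<close>

text \<open>
  Summing \<open>f\<close> over the \<open>k \<ge> 2\<close> lines of \<open>H\<close> through \<open>v\<close> gives \<open>(k - 1) (q - 1) f v + S = 0\<close>,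
  where \<open>S\<close> is the total of \<open>f\<close> on \<open>H\<close>. So no value of \<open>f\<close> has the sign of \<open>S\<close>, whence \<open>S = 0\<close>.
\<close>

lemma weights_vanish_on_plane:
  fixes f :: "'a::{field,finite} ^ 4 \<Rightarrow> real"
  assumes H: "vec.subspace H" "vec.dim H = 3"
    and f: "f 0 = 0" "\<And>k v. k \<noteq> 0 \<Longrightarrow> f (k *s v) = f v"
    and lines: "\<And>W. line_space W \<Longrightarrow> W \<subseteq> H \<Longrightarrow> (\<Sum>v\<in>W. f v) = 0"
    and "v \<in> H"
  shows "f v = 0"
proof -
  let ?q = "real CARD('a)"
  define S where "S = (\<Sum>w\<in>H. f w)"
  have q: "?q > 1" by (rule card_field_gt_1)
  have key: "\<exists>r>0. r * f v + S = 0" if v: "v \<in> H" "v \<noteq> 0" for v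
  proof -
    define K where "K = {W. line_space W \<and> v \<in> W \<and> W \<subseteq> H}"
    have span_K: "vec.span {v, w} \<in> K" if "w \<in> H" "w \<notin> vec.span {v}" for w
      using line_space_span[OF v(2) that(2)] vec.span_base[of v "{v, w}"]
        vec.span_minimal[of "{v, w}" H] v that H by (simp add: K_def)
    have "\<not> H \<subseteq> vec.span {v}"
      using vec.dim_subset[of H "vec.span {v}"] H vec.dim_le_card[of "vec.span {v}" "{v}"] by auto
    then obtain w where w: "w \<in> H" "w \<notin> vec.span {v}" by blast
    have "\<not> H \<subseteq> vec.span {v, w}"
      using vec.dim_subset[of H "vec.span {v, w}"] H line_space_span[OF v(2) w(2)]
      by (auto simp: line_space_def)
    then obtain w' where w': "w' \<in> H" "w' \<notin> vec.span {v, w}" by blast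
    have w'v: "w' \<notin> vec.span {v}" using w'(2) vec.span_mono[of "{v}" "{v, w}"] by blast
    have "w' \<in> vec.span {v, w'}" by (simp add: vec.span_base)
    then have "card {vec.span {v, w}, vec.span {v, w'}} = 2" using w' by (auto simp: card_2_iff)
    moreover have "{vec.span {v, w}, vec.span {v, w'}} \<subseteq> K" using span_K w w' w'v by simp
    ultimately have K2: "card K \<ge> 2" using card_mono[OF finite] by metis
    have sv: "vec.span {v} \<subseteq> H" using v H by (intro vec.span_minimal) auto
    \<comment> \<open>Multiples of \<open>v\<close> lie on all lines of \<open>K\<close>, every
      other vector of \<open>H\<close> on just one. The double sum below is thus \<open>S\<close>
      plus \<open>card K - 1\<close> extra copies of the weight on the span of
      \<open>v\<close>.\<close>
    have cnt: "real (card {W \<in> K. w \<in> W}) = 1 + (real (card K) - 1) * of_bool (w \<in> vec.span {v})"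
      if "w \<in> H" for w
    proof (cases "w \<in> vec.span {v}")
      case True
      have "w \<in> W" if "W \<in> K" for W
      proof -
        have "vec.span {v} \<subseteq> W" using that by (intro vec.span_minimal) (auto simp: K_def line_space_def)
        then show ?thesis using True by blast
      qed
      then have "{W \<in> K. w \<in> W} = K" by blast
      then show ?thesis using True by simp
    next
      case False
      have "{W \<in> K. w \<in> W} = {vec.span {v, w}}"
        using span_K[OF that False] line_space_eq_span[OF _ _ _ v(2) False] vec.span_base[of w "{v, w}"]
        by (auto simp: K_def)
      then show ?thesis using False by simp
    qed
    have "0 = (\<Sum>W\<in>K. \<Sum>w\<in>W. f w)" using lines by (simp add: K_def)
    also have "\<dots> = (\<Sum>W\<in>K. \<Sum>w\<in>H. f w * of_bool (w \<in> W))"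
    proof (rule sum.cong[OF refl])
      fix W assume "W \<in> K"
      then have "H \<inter> W = W" by (auto simp: K_def)
      then show "(\<Sum>w\<in>W. f w) = (\<Sum>w\<in>H. f w * of_bool (w \<in> W))"
        by (simp add: of_bool_def if_distrib sum.If_cases cong: if_cong)
    qed
    also have "\<dots> = (\<Sum>w\<in>H. \<Sum>W\<in>K. f w * of_bool (w \<in> W))" by (rule sum.swap)
    also have "\<dots> = (\<Sum>w\<in>H. f w * real (card {W \<in> K. w \<in> W}))"
      by (simp add: of_bool_def if_distrib sum.If_cases Int_def mult.commute cong: if_cong)
    also have "\<dots> = (\<Sum>w\<in>H. f w + (real (card K) - 1) * (f w * of_bool (w \<in> vec.span {v})))"
      by (intro sum.cong refl) (simp add: cnt algebra_simps)
    also have "\<dots> = S + (real (card K) - 1) * (\<Sum>w\<in>H. f w * of_bool (w \<in> vec.span {v}))"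
      by (simp only: sum.distrib sum_distrib_left S_def)
    also have "(\<Sum>w\<in>H. f w * of_bool (w \<in> vec.span {v})) = (\<Sum>w\<in>vec.span {v}. f w)"
      using sv by (simp add: of_bool_def if_distrib sum.If_cases Int_absorb1 cong: if_cong)
    also have "\<dots> = (\<Sum>a\<in>UNIV. f (a *s v))"
      using sum_span_insert[of v "{}" f] v(2) by simp
    also have "\<dots> = (\<Sum>a\<in>UNIV - {0 :: 'a}. f v)"
      using f by (simp add: sum.remove[of UNIV "0 :: 'a"])
    also have "\<dots> = (?q - 1) * f v"
      using q by (simp add: card_Diff_singleton of_nat_diff)
    finally have "((real (card K) - 1) * (?q - 1)) * f v + S = 0" by (simp add: algebra_simps)
    moreover have "(real (card K) - 1) * (?q - 1) > 0" using K2 q by simp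
    ultimately show ?thesis by blast
  qed
  \<comment> \<open>Multiplying by \<open>S\<close> turns the sign argument into inequalities that
    add up over \<open>H\<close> to \<open>S * S \<le> 0\<close>.\<close>
  have "S * f w \<le> 0" if w: "w \<in> H" for w
  proof (cases "w = 0")
    case False
    then obtain r where "r > 0" "S = - (r * f w)" using key[OF w] by (metis add_eq_0_iff)
    then show ?thesis by (simp add: mult.assoc)
  qed (use f in simp)
  then have "(\<Sum>w\<in>H. S * f w) \<le> 0" by (rule sum_nonpos)
  then have "S * S \<le> 0" by (simp add: S_def sum_distrib_left)
  then have "S = 0" by (auto simp: mult_le_0_iff)
  then show ?thesis using key[OF \<open>v \<in> H\<close>] f(1) by (cases "v = 0") auto
qed

text \<open>Vectors of \<open>H\<close> may be covered any number of times, or not at all, since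
  they carry no weight. Hence the same total results for affine and for projective spreads.\<close>

lemma sum_weights_spread:
  fixes f :: "'a::{field,finite} ^ 4 \<Rightarrow> real"
  assumes "\<And>v. v \<in> H \<Longrightarrow> f v = 0" and cover: "\<And>v. v \<notin> H \<Longrightarrow> \<exists>!W. W \<in> S \<and> v \<in> W"
  shows "(\<Sum>W\<in>S. \<Sum>v\<in>W. f v) = (\<Sum>v\<in>UNIV. f v)"
proof -
  have "(\<Sum>W\<in>S. \<Sum>v\<in>W. f v) = (\<Sum>W\<in>S. \<Sum>v\<in>UNIV. f v * of_bool (v \<in> W))"
    by (simp add: of_bool_def if_distrib sum.If_cases cong: if_cong)
  also have "\<dots> = (\<Sum>v\<in>UNIV. \<Sum>W\<in>S. f v * of_bool (v \<in> W))" by (rule sum.swap)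
  also have "\<dots> = (\<Sum>v\<in>UNIV. f v * real (card {W \<in> S. v \<in> W}))"
    by (simp add: of_bool_def if_distrib sum.If_cases Int_def mult.commute cong: if_cong)
  also have "\<dots> = (\<Sum>v\<in>UNIV. f v)"
  proof (intro sum.cong refl)
    fix v
    show "f v * real (card {W \<in> S. v \<in> W}) = f v"
    proof (cases "v \<in> H")
      case False
      then obtain W where "W \<in> S" "v \<in> W" "\<And>U. U \<in> S \<Longrightarrow> v \<in> U \<Longrightarrow> U = W" using cover by metis
      then have "{W \<in> S. v \<in> W} = {W}" by blast
      then show ?thesis by simp
    qed (simp add: assms)
  qed
  finally show ?thesis .
qed

section \<open>Comparing affine and projective spreads\<close>

text \<open>Two skew lines span a space of dimension 4, too large for \<open>H\<close>. A spread
  through a line at infinity therefore has no second line there, and its remaining lines form an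
  affine spread.\<close>

lemma lines_in_plane_meet:
  assumes "vec.subspace H" "vec.dim H = 3" "line_space W" "line_space U" "W \<subseteq> H" "U \<subseteq> H"
  shows "W \<inter> U \<noteq> {0}"
proof
  assume "W \<inter> U = {0}"
  moreover have "vec.dim {x + y | x y. x \<in> W \<and> y \<in> U} + vec.dim (W \<inter> U) = vec.dim W + vec.dim U"
    using assms by (intro vec.dim_sums_Int) (simp_all add: line_space_def)
  ultimately have "vec.dim {x + y | x y. x \<in> W \<and> y \<in> U} = 4"
    using assms by (simp add: line_space_def)
  moreover have "{x + y | x y. x \<in> W \<and> y \<in> U} \<subseteq> H"
    using assms by (auto intro!: vec.subspace_add)
  ultimately show False using vec.dim_subset[of "{x + y | x y. x \<in> W \<and> y \<in> U}" H] assms(2) by simp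
qed

theorem theorem3p8:
  fixes \<pi> :: "('a::{field,finite} ^ 4) set set"
    and L :: "('a ^ 4) set set set"
    and x :: nat
  assumes "\<pi> \<in> pg_planes"
    and "cameron_liebler pg_points pg_lines x L"
  shows "cameron_liebler (ag_points \<pi>) (ag_lines \<pi>) x (affine_part \<pi> L) \<longleftrightarrow>
         L \<inter> {l \<in> pg_lines. l \<subseteq> \<pi>} = {}"
proof -
  obtain H where H: "\<pi> = points_of H" "vec.subspace H" "vec.dim H = 3"
    using assms(1) by (auto simp: pg_planes_def)
  define P where "P = (\<lambda>W. points_of W \<in> L)"
  have L: "L \<subseteq> pg_lines" using assms(2) by (simp add: cameron_liebler_def)
  have pg: "card {W \<in> S. P W} = x"
    if "\<forall>W\<in>S. line_space W" "\<forall>v. v \<noteq> 0 \<longrightarrow> (\<exists>!W. W \<in> S \<and> v \<in> W)" for S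
    using assms(2) that unfolding cameron_liebler_pg_iff[OF L] P_def by blast
  have disj: "L \<inter> {l \<in> pg_lines. l \<subseteq> \<pi>} = {} \<longleftrightarrow> (\<forall>W. line_space W \<and> W \<subseteq> H \<longrightarrow> \<not> P W)"
  proof -
    have sub: "points_of W \<subseteq> \<pi> \<longleftrightarrow> W \<subseteq> H" if "line_space W" for W
      using points_of_subset_iff[OF _ H(2)] that by (simp add: line_space_def H(1))
    have "L \<inter> {l \<in> pg_lines. l \<subseteq> \<pi>} = {} \<longleftrightarrow> (\<forall>l\<in>pg_lines. l \<subseteq> \<pi> \<longrightarrow> l \<notin> L)"
      by blast
    also have "\<dots> \<longleftrightarrow> (\<forall>W. line_space W \<longrightarrow> points_of W \<subseteq> \<pi> \<longrightarrow> points_of W \<notin> L)"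
      unfolding pg_lines_def line_space_def[symmetric] by blast
    also have "\<dots> \<longleftrightarrow> (\<forall>W. line_space W \<and> W \<subseteq> H \<longrightarrow> \<not> P W)"
      unfolding P_def using sub by (metis (no_types, lifting))
    finally show ?thesis .
  qed
  show ?thesis unfolding disj
  proof
    assume "cameron_liebler (ag_points \<pi>) (ag_lines \<pi>) x (affine_part \<pi> L)"
    then have ag: "card {W \<in> S. P W} = x"
      if "\<forall>W\<in>S. line_space W \<and> \<not> W \<subseteq> H" "\<forall>v. v \<notin> H \<longrightarrow> (\<exists>!W. W \<in> S \<and> v \<in> W)" for S
      using that unfolding H(1) cameron_liebler_iff[OF H(2) L] P_def by blast
    show "\<forall>W. line_space W \<and> W \<subseteq> H \<longrightarrow> \<not> P W"
    proof (intro allI impI notI, elim conjE)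
      fix W :: "('a ^ 4) set" assume W: "line_space W" "W \<subseteq> H" "P W"
      obtain S where S: "\<And>U. U \<in> S \<Longrightarrow> line_space U \<and> W \<inter> U = {0}"
        and cov: "\<And>v. v \<noteq> 0 \<Longrightarrow> \<exists>!U. U \<in> insert W S \<and> v \<in> U"
        using spread_through_line[OF W(1)] by blast
      have "card {U \<in> insert W S. P U} = x" using S W cov by (intro pg) auto
      moreover have "card {U \<in> S. P U} = x"
      proof (rule ag)
        show "\<forall>U\<in>S. line_space U \<and> \<not> U \<subseteq> H"
          using S lines_in_plane_meet[OF H(2,3) W(1) _ W(2)] by blast
        show "\<forall>v. v \<notin> H \<longrightarrow> (\<exists>!U. U \<in> S \<and> v \<in> U)"
        proof (intro allI impI)
          fix v assume "v \<notin> H"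
          then have "v \<noteq> 0" "v \<notin> W" using vec.subspace_0[OF H(2)] W(2) by auto
          then show "\<exists>!U. U \<in> S \<and> v \<in> U" using cov[of v] by (auto cong: conj_cong)
        qed
      qed
      \<comment> \<open>Inserting the class line \<open>W\<close> into \<open>S\<close> raises the
        count by one, although both counts equal \<open>x\<close>.\<close>
      moreover have "W \<notin> S" using S[of W] line_space_not_subset_zero[OF W(1)] by auto
      moreover have "{U \<in> insert W S. P U} = insert W {U \<in> S. P U}" using W(3) by auto
      ultimately show False by simp
    qed
  next
    assume noL: "\<forall>W. line_space W \<and> W \<subseteq> H \<longrightarrow> \<not> P W"
    obtain f :: "'a ^ 4 \<Rightarrow> real" where f: "f 0 = 0" "\<And>k v. k \<noteq> 0 \<Longrightarrow> f (k *s v) = f v"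
      "\<And>W. line_space W \<Longrightarrow> (\<Sum>v\<in>W. f v) = of_bool (P W)"
      using line_class_weights[of P x] pg by blast
    have fH: "f v = 0" if "v \<in> H" for v
      using weights_vanish_on_plane[OF H(2,3) f(1,2) _ that] f(3) noL by simp
    have card_S: "real (card {W \<in> S. P W}) = (\<Sum>v\<in>UNIV. f v)"
      if "\<And>W. W \<in> S \<Longrightarrow> line_space W" "\<And>v. v \<notin> H \<Longrightarrow> \<exists>!W. W \<in> S \<and> v \<in> W" for S
    proof -
      have "(\<Sum>W\<in>S. \<Sum>v\<in>W. f v) = (\<Sum>W\<in>S. of_bool (P W))"
        using that(1) f(3) by simp
      also have "\<dots> = real (card {W \<in> S. P W})"
        by (simp add: sum.If_cases of_bool_def Int_def)
      finally show ?thesis using sum_weights_spread[OF fH that(2)] by simp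
    qed
    \<comment> \<open>A projective spread also covers each vector outside \<open>H\<close> exactly
      once, so its count \<open>x\<close> is the total weight. Any line serves to produce such a
      spread.\<close>
    have "(\<Sum>v\<in>UNIV. f v) = real x"
    proof -
      have "\<not> H \<subseteq> {0}" using vec.dim_subset[of H "{0}"] H(3) by auto
      then obtain v :: "'a ^ 4" where v: "v \<noteq> 0" by blast
      have "\<not> H \<subseteq> vec.span {v}"
        using vec.dim_subset[of H "vec.span {v}"] H(3) vec.dim_le_card[of "vec.span {v}" "{v}"] by auto
      then obtain w where "w \<notin> vec.span {v}" by blast
      then have W: "line_space (vec.span {v, w})" using line_space_span v by blast
      obtain S where S: "\<And>U. U \<in> S \<Longrightarrow> line_space U \<and> vec.span {v, w} \<inter> U = {0}"
        and cover: "\<And>u. u \<noteq> 0 \<Longrightarrow> \<exists>!U. U \<in> insert (vec.span {v, w}) S \<and> u \<in> U"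
        using spread_through_line[OF W] by blast
      define S' where "S' = insert (vec.span {v, w}) S"
      have lines: "line_space U" if "U \<in> S'" for U
        using that S W by (auto simp: S'_def)
      have cover': "\<exists>!U. U \<in> S' \<and> u \<in> U" if "u \<noteq> 0" for u
        unfolding S'_def using that by (rule cover)
      have "\<exists>!U. U \<in> S' \<and> u \<in> U" if "u \<notin> H" for u
      proof -
        have "u \<noteq> 0" using that vec.subspace_0[OF H(2)] by blast
        then show ?thesis by (rule cover')
      qed
      with lines have "real (card {W \<in> S'. P W}) = (\<Sum>v\<in>UNIV. f v)" by (rule card_S)
      moreover have "card {W \<in> S'. P W} = x" by (rule pg) (simp_all add: lines cover')
      ultimately show ?thesis by simp
    qed
    then show "cameron_liebler (ag_points \<pi>) (ag_lines \<pi>) x (affine_part \<pi> L)"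
      unfolding H(1) cameron_liebler_iff[OF H(2) L]
      using card_S by (simp add: P_def)
  qed
qed

end
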